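(* For integers $n\ge 0$ and $k\ge 1$, let $P(n,k,2)$ denote the probability that a sequence of $n$ independent letters, each uniformly distributed on $\{1,2\}$, is $k$-omni. Then $P(3k-1,k,2)=\frac12$ for each integer $k\ge 1$. Furthermore, for every constant integer $c$, $P(3k+c,k,2)\to\frac12$ as $k\to\infty$.
   Context: A finite sequence over a two-letter alphabet is called $k$-omni if every one of the $2^k$ words of length $k$ over that alphabet occurs in it as a (not necessarily contiguous) subsequence. *)

theory Defs
  imports "HOL-Probability.Probability" "HOL-Library.Sublist"
begin

(* xs is meant to be a sequence over the alphabet A *)
definition omni :: "'a set \<Rightarrow> nat \<Rightarrow> 'a list \<Rightarrow> bool" where
  "omni A k xs \<longleftrightarrow> (\<forall>w. set w \<subseteq> A \<and> length w = k \<longrightarrow> subseq w xs)"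

(* P(n,k,m) for m letters; meaningful for m > 0 only, as the uniform distribution needs a
   non-empty alphabet *)
definition omni_prob :: "nat \<Rightarrow> nat \<Rightarrow> nat \<Rightarrow> real" where
  "omni_prob n k m =
     measure_pmf.prob (replicate_pmf n (pmf_of_set {1..m})) {xs. omni {1..m} k xs}"

end

theory Submission
  imports Defs "HOL-Real_Asymp.Real_Asymp"
begin

text \<open>
  Scan the sequence greedily, closing a round as soon as both letters have occurred since the
  last round was closed: the sequence is k-omni iff at least k rounds are completed. In each round the first
  letter is always useful, and every further letter closes the round with probability 1/2. Hence
  \<open>P(n,k,2)\<close> is the probability of at least \<open>k\<close> heads in \<open>n - k\<close> fair coin flips, which is 1/2
  by symmetry if \<open>n - k = 2 k - 1\<close>. Changing the number of flips by one changes this probability by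
  at most a single binomial weight, which tends to 0.
\<close>

section \<open>Rounds of the greedy scan\<close>

text \<open>The state inside a round in which \<open>y\<close> is the missing letter and \<open>k\<close> rounds remain afterwards.\<close>

definition omni_from :: "'a set \<Rightarrow> 'a \<Rightarrow> nat \<Rightarrow> 'a list \<Rightarrow> bool" where
  "omni_from A y k xs \<longleftrightarrow> (\<forall>w. set w \<subseteq> A \<and> length w = k \<longrightarrow> subseq (y # w) xs)"

lemma omni_0 [simp]: "omni A 0 xs"
  by (simp add: omni_def)

lemma not_omni_from_Nil [simp]: "y \<in> A \<Longrightarrow> \<not> omni_from A y k []"
  by (auto simp: omni_from_def intro!: exI[of _ "replicate k y"])

lemma not_omni_Suc_Nil [simp]: "y \<in> A \<Longrightarrow> \<not> omni A (Suc k) []"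
  by (auto simp: omni_def intro!: exI[of _ "replicate (Suc k) y"])

lemma omni_from_Cons_same [simp]: "omni_from A y k (y # xs) \<longleftrightarrow> omni A k xs"
  by (simp add: omni_from_def omni_def)

lemma omni_from_Cons_other [simp]: "x \<noteq> y \<Longrightarrow> omni_from A y k (x # xs) \<longleftrightarrow> omni_from A y k xs"
  by (simp add: omni_from_def)

text \<open>The words starting with the missing letter \<open>y\<close> are the only critical ones:
  once \<open>y # w\<close> embeds in \<open>xs\<close>, so does \<open>w\<close>, and then
  \<open>x # w\<close> embeds in \<open>x # xs\<close>.\<close>

lemma omni_Suc_Cons:
  assumes "x \<noteq> y"
  shows "omni {x, y} (Suc k) (x # xs) \<longleftrightarrow> omni_from {x, y} y k xs"
proof
  assume *: "omni {x, y} (Suc k) (x # xs)"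
  show "omni_from {x, y} y k xs"
    unfolding omni_from_def
  proof (intro allI impI)
    fix w assume "set w \<subseteq> {x, y} \<and> length w = k"
    then have "subseq (y # w) (x # xs)"
      using * unfolding omni_def by (metis insert_subset insertCI length_Cons list.simps(15))
    then show "subseq (y # w) xs" using assms by simp
  qed
next
  assume *: "omni_from {x, y} y k xs"
  show "omni {x, y} (Suc k) (x # xs)"
    unfolding omni_def
  proof (intro allI impI)
    fix v assume v: "set v \<subseteq> {x, y} \<and> length v = Suc k"
    then obtain z w where zw: "v = z # w" by (cases v) auto
    then have "subseq (y # w) xs" using * v by (auto simp: omni_from_def)
    then show "subseq v (x # xs)"
      using v zw assms by (auto dest: subseq_Cons')
  qed
qed

section \<open>Reduction to fair-coin tails and their symmetric value\<close>

lemma prob_replicate_pmf_Suc: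
  fixes a b :: 'a
  assumes "a \<noteq> b"
  shows "measure_pmf.prob (replicate_pmf (Suc n) (pmf_of_set {a, b})) {xs. Q xs} =
    (measure_pmf.prob (replicate_pmf n (pmf_of_set {a, b})) {xs. Q (a # xs)} +
     measure_pmf.prob (replicate_pmf n (pmf_of_set {a, b})) {xs. Q (b # xs)}) / 2"
proof -
  let ?R = "replicate_pmf n (pmf_of_set {a, b})"
  \<comment> \<open>Finite support allows the expectation over the bind to be expanded as a finite
    sum over the first letter.\<close>
  have fin: "finite (set_pmf ?R)"
    using finite_lists_length_eq[of "{a, b}" n] assms
    by (simp add: set_replicate_pmf lists_eq_set)
  have "replicate_pmf (Suc n) (pmf_of_set {a, b}) =
      bind_pmf (pmf_of_set {a, b}) (\<lambda>x. map_pmf ((#) x) ?R)"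
    by (simp add: map_pmf_def)
  then have "measure_pmf.prob (replicate_pmf (Suc n) (pmf_of_set {a, b})) {xs. Q xs} =
      measure_pmf.expectation (bind_pmf (pmf_of_set {a, b}) (\<lambda>x. map_pmf ((#) x) ?R))
        (indicator {xs. Q xs})"
    by simp
  also have "\<dots> = (\<Sum>x\<in>{a, b}. measure_pmf.prob (map_pmf ((#) x) ?R) {xs. Q xs} / 2)"
    using assms fin
    by (subst pmf_expectation_bind_pmf_of_set) (simp_all del: measure_map_pmf integral_map_pmf)
  also have "\<dots> = (measure_pmf.prob ?R {xs. Q (a # xs)} + measure_pmf.prob ?R {xs. Q (b # xs)}) / 2"
    using assms by (simp add: vimage_def add_divide_distrib)
  finally show ?thesis .
qed

text \<open>The upper tail of the binomial distribution with parameters \<open>m\<close> and 1/2,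
  kept as a finite sum so that Pascal's rule and row sums apply directly.\<close>

definition heads_tail :: "nat \<Rightarrow> nat \<Rightarrow> real" where
  "heads_tail m k = (\<Sum>j=k..m. real (m choose j)) / 2 ^ m"

lemma heads_tail_0 [simp]: "heads_tail m 0 = 1"
proof -
  have "(\<Sum>j=0..m. real (m choose j)) = real (2 ^ m)"
    unfolding choose_row_sum[symmetric] of_nat_sum by (simp add: atMost_atLeast0)
  then show ?thesis by (simp add: heads_tail_def)
qed

lemma heads_tail_eq_0 [simp]: "m < k \<Longrightarrow> heads_tail m k = 0"
  by (simp add: heads_tail_def)

lemma heads_tail_step: "heads_tail m k = heads_tail m (Suc k) + real (m choose k) / 2 ^ m"
proof (cases "k \<le> m")
  case True
  then show ?thesis
    by (simp add: heads_tail_def sum.atLeast_Suc_atMost add_divide_distrib)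
qed (simp add: binomial_eq_0)

lemma heads_tail_Suc_Suc:
  "heads_tail (Suc m) (Suc k) = (heads_tail m k + heads_tail m (Suc k)) / 2"
proof -
  have "(\<Sum>j=Suc k..Suc m. real (Suc m choose j)) =
      (\<Sum>j=k..m. real (m choose j)) + (\<Sum>j=k..m. real (m choose Suc j))"
    by (subst sum.shift_bounds_cl_Suc_ivl) (simp add: sum.distrib)
  also have "(\<Sum>j=k..m. real (m choose Suc j)) = (\<Sum>j=Suc k..Suc m. real (m choose j))"
    by (subst sum.shift_bounds_cl_Suc_ivl) simp
  \<comment> \<open>The dropped top term is \<open>m choose Suc m\<close>, which is 0.\<close>
  also have "\<dots> = (\<Sum>j=Suc k..m. real (m choose j))"
    by (rule sum.mono_neutral_right) (auto simp: le_Suc_eq)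
  finally show ?thesis
    by (simp add: heads_tail_def add_divide_distrib)
qed

text \<open>An extra flip matters only if the first \<open>m\<close> flips show exactly
  \<open>k\<close> heads and the extra one is a head.\<close>

lemma heads_tail_Suc_diff:
  "heads_tail (Suc m) (Suc k) - heads_tail m (Suc k) = real (m choose k) / 2 ^ m / 2"
  unfolding heads_tail_Suc_Suc heads_tail_step[of m k] by (simp add: field_simps)

text \<open>For \<open>n < k\<close> the truncated difference is harmless: both sides of the equations are 0.\<close>

lemma prob_omni_binary:
  fixes a b :: 'a
  assumes "a \<noteq> b"
  defines "p n Q \<equiv> measure_pmf.prob (replicate_pmf n (pmf_of_set {a, b})) {xs. Q xs}"
  shows "p n (omni {a, b} k) = heads_tail (n - k) k"
    and "y \<in> {a, b} \<Longrightarrow> p n (omni_from {a, b} y k) = heads_tail (n - k) (Suc k)"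
proof (induction n arbitrary: k y)
  case 0
  {
    case 1
    show ?case using not_omni_Suc_Nil[of a "{a, b}"]
      by (cases k) (simp_all add: p_def)
  next
    case 2
    then show ?case using not_omni_from_Nil[of y "{a, b}" k] by (simp add: p_def)
  }
next
  case (Suc n)
  note rec = prob_replicate_pmf_Suc[OF assms(1), of n, folded p_def]
  {
    case 1
    have "omni {a, b} (Suc j) (b # xs) \<longleftrightarrow> omni_from {a, b} a j xs" for j xs
      using omni_Suc_Cons[of b a j xs] assms(1) by (simp add: insert_commute)
    then show ?case
      using assms(1) by (cases k) (simp_all add: rec omni_Suc_Cons Suc.IH, simp add: p_def)
  next
    case 2
    \<comment> \<open>The letter \<open>y\<close> closes the round and the other letter leaves it
      open: one fair flip. If \<open>n < k\<close>, all three tails are 0.\<close>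
    have "heads_tail (Suc n - k) (Suc k) = (heads_tail (n - k) k + heads_tail (n - k) (Suc k)) / 2"
      by (cases "k \<le> n") (simp_all add: Suc_diff_le heads_tail_Suc_Suc)
    moreover from 2 have "y = a \<or> y = b" by simp
    ultimately show ?case
      using assms(1) by (elim disjE) (simp_all add: rec Suc.IH)
  }
qed

lemma omni_prob_2: "omni_prob n k 2 = heads_tail (n - k) k"
proof -
  have "{1..2} = {1, 2::nat}" by auto
  then show ?thesis
    using prob_omni_binary(1)[of "1::nat" 2 n k] by (simp add: omni_prob_def)
qed

text \<open>With an odd number of flips, heads and tails are equally likely to be in the majority;
  \<open>binomial_r_part_sum\<close> supplies the half row sum.\<close>

lemma heads_tail_half: "heads_tail (2 * k + 1) (k + 1) = 1 / 2"
proof -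
  let ?c = "\<lambda>j. real (2 * k + 1 choose j)"
  have "(\<Sum>j\<le>k. ?c j) = real (2 ^ (2 * k))"
    unfolding binomial_r_part_sum[symmetric] by simp
  moreover have "(\<Sum>j\<le>2 * k + 1. ?c j) = real (2 ^ (2 * k + 1))"
    unfolding choose_row_sum[symmetric] by simp
  moreover have "(\<Sum>j\<le>2 * k + 1. ?c j) = (\<Sum>j\<le>k. ?c j) + (\<Sum>j=k+1..2 * k + 1. ?c j)"
  proof -
    have "{..2 * k + 1} = {..k} \<union> {k+1..2 * k + 1}" by auto
    then show ?thesis by (simp add: sum.union_disjoint del: sum.atMost_Suc)
  qed
  moreover have "real (2 ^ (2 * k + 1)) = 2 * real (2 ^ (2 * k))" by simp
  ultimately have "(\<Sum>j=k+1..2 * k + 1. ?c j) = real (2 ^ (2 * k))" by linarith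
  then show ?thesis
    unfolding heads_tail_def by (simp only:) simp
qed

section \<open>A uniform bound on binomial weights\<close>

text \<open>Consecutive central coefficients have ratio \<open>2 * (2 * n + 1) / (n + 1)\<close>, so
  the induction step comes down to
  \<open>(2 * n + 1) * (2 * n + 3) \<le> 4 * (n + 1)\<^sup>2\<close>.\<close>

lemma central_binomial_square_le: "(2 * n + 1) * (2 * n choose n)\<^sup>2 \<le> 4 ^ (2 * n)"
proof (induction n)
  case (Suc n)
  define u where "u = (2 * n choose n)"
  define v where "v = (2 * Suc n choose Suc n)"
  have "(n + 1) * v = 2 * (2 * n + 1) * u"
  proof -
    have "(n + 1) * v = 2 * (Suc n * (Suc (2 * n) choose Suc n))"
    proof -
      have "(Suc (2 * n) choose Suc n) = (Suc (2 * n) choose n)"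
        using binomial_symmetric[of "Suc n" "Suc (2 * n)"] by simp
      then show ?thesis by (simp add: v_def)
    qed
    also have "Suc n * (Suc (2 * n) choose Suc n) = Suc (2 * n) * u"
      unfolding u_def by (rule Suc_times_binomial)
    finally show ?thesis by simp
  qed
  then have "(n + 1)\<^sup>2 * v\<^sup>2 = (2 * (2 * n + 1) * u)\<^sup>2"
    by (metis power_mult_distrib)
  then have "(n + 1)\<^sup>2 * ((2 * n + 3) * v\<^sup>2) = (2 * n + 3) * (2 * (2 * n + 1) * u)\<^sup>2"
    by (metis mult.left_commute)
  also have "\<dots> = 4 * ((2 * n + 1) * (2 * n + 3)) * ((2 * n + 1) * u\<^sup>2)"
    by (simp add: power2_eq_square algebra_simps)
  also have "\<dots> \<le> 4 * (4 * (n + 1)\<^sup>2) * 4 ^ (2 * n)"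
  proof (rule mult_mono)
    show "(2 * n + 1) * u\<^sup>2 \<le> 4 ^ (2 * n)" using Suc.IH by (simp only: u_def)
  qed (simp_all add: power2_eq_square algebra_simps)
  also have "\<dots> = (n + 1)\<^sup>2 * 4 ^ (2 * Suc n)" by simp
  finally have "(2 * n + 3) * v\<^sup>2 \<le> 4 ^ (2 * Suc n)" by simp
  moreover have "2 * Suc n + 1 = 2 * n + 3" by simp
  ultimately show ?case by (simp only: v_def)
qed simp

text \<open>The middle entry of a row is the largest. For odd \<open>m\<close> it is half the
  central coefficient of row \<open>m + 1\<close>, so the even case applies there.\<close>

lemma binomial_square_le: "(m + 1) * (m choose j)\<^sup>2 \<le> 4 ^ m"
proof -
  have *: "(m + 1) * (m choose (m div 2))\<^sup>2 \<le> 4 ^ m"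
  proof (cases "even m")
    case True
    then obtain n where "m = 2 * n" by (elim evenE)
    then show ?thesis using central_binomial_square_le[of n] by simp
  next
    case False
    then obtain n where m: "m = 2 * n + 1" by (elim oddE)
    have "(Suc (2 * n) choose Suc n) = (Suc (2 * n) choose n)"
      using binomial_symmetric[of "Suc n" "Suc (2 * n)"] by simp
    then have "(2 * Suc n choose Suc n) = 2 * (m choose n)" by (simp add: m)
    then have "(2 * Suc n choose Suc n)\<^sup>2 = 4 * (m choose n)\<^sup>2"
      by (simp only: power_mult_distrib) simp
    with central_binomial_square_le[of "Suc n"]
    have "(m + 2) * (4 * (m choose n)\<^sup>2) \<le> 4 ^ (m + 1)"
      by (simp only: m) simp
    moreover have "(m + 1) * (m choose n)\<^sup>2 \<le> (m + 2) * (m choose n)\<^sup>2" by simp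
    ultimately show ?thesis by (simp add: m)
  qed
  have "(m choose j)\<^sup>2 \<le> (m choose (m div 2))\<^sup>2"
    by (intro power_mono binomial_maximum) simp
  then show ?thesis using * by (meson le_trans mult_le_mono2)
qed

lemma binomial_weight_le: "real (m choose j) / 2 ^ m \<le> 1 / sqrt (real (m + 1))"
proof (rule power2_le_imp_le)
  have "real ((m + 1) * (m choose j)\<^sup>2) \<le> real (4 ^ m)"
    using binomial_square_le of_nat_le_iff by blast
  then have "real (m + 1) * (real (m choose j))\<^sup>2 \<le> 4 ^ m"
    by (simp only: of_nat_mult of_nat_power of_nat_numeral)
  moreover have "(2 ^ m)\<^sup>2 = (4 ^ m :: real)"
    by (simp add: power2_eq_square flip: power_mult_distrib)
  ultimately show "(real (m choose j) / 2 ^ m)\<^sup>2 \<le> (1 / sqrt (real (m + 1)))\<^sup>2"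
    by (simp add: power_divide divide_simps mult.commute del: of_nat_Suc)
qed simp

section \<open>Passage to the limit\<close>

lemma heads_tail_Suc_diff_bounds:
  assumes "k > 0"
  shows "heads_tail (Suc m) k - heads_tail m k \<in> {0..1 / sqrt (real (m + 1))}"
proof -
  obtain j where "k = Suc j" using assms gr0_implies_Suc by blast
  moreover have "x / 2 \<le> x" if "x \<ge> 0" for x :: real using that by simp
  then have "real (m choose j) / 2 ^ m / 2 \<le> real (m choose j) / 2 ^ m"
    by (meson divide_nonneg_nonneg of_nat_0_le_iff zero_le_numeral zero_le_power)
  ultimately show ?thesis
    using binomial_weight_le[of m j] heads_tail_Suc_diff[of m j] by auto
qed

lemma heads_tail_shift_diff_tendsto_0:
  fixes c :: int
  shows "(\<lambda>k. heads_tail (nat (2 * int k + (c + 1))) k - heads_tail (nat (2 * int k + c)) k)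
    \<longlonglongrightarrow> 0" (is "?d \<longlonglongrightarrow> 0")
proof (rule tendsto_sandwich)
  let ?b = "\<lambda>k. 1 / sqrt (2 * real k + real_of_int c + 1)"
  have ev: "\<forall>\<^sub>F k in sequentially. ?d k \<in> {0..?b k}"
    \<comment> \<open>From this threshold on, \<open>2 * int k + c\<close> is nonnegative, so
      \<open>nat\<close> does not truncate.\<close>
    using eventually_ge_at_top[of "nat (\<bar>c\<bar> + 1)"]
  proof eventually_elim
    case (elim k)
    then have pos: "2 * int k + c \<ge> 0" and k: "k > 0" by linarith+
    have eq: "nat (2 * int k + (c + 1)) = Suc (nat (2 * int k + c))" using pos by simp
    have "real (nat (2 * int k + c) + 1) = 2 * real k + real_of_int c + 1"
      using pos by simp
    then show ?case
      using heads_tail_Suc_diff_bounds[OF k, of "nat (2 * int k + c)"] unfolding eq by metis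
  qed
  show "\<forall>\<^sub>F k in sequentially. 0 \<le> ?d k" "\<forall>\<^sub>F k in sequentially. ?d k \<le> ?b k"
    using ev by (auto elim: eventually_mono)
  show "?b \<longlonglongrightarrow> 0" by real_asymp
qed simp

text \<open>Induction on \<open>c\<close> in both directions from -1, where symmetry gives the exact
  value; each unit step changes the sequence by a null sequence.\<close>

lemma heads_tail_tendsto_half:
  fixes c :: int
  shows "(\<lambda>k. heads_tail (nat (2 * int k + c)) k) \<longlonglongrightarrow> 1 / 2"
proof (induction c rule: int_induct[where k = "-1"])
  case base
  \<comment> \<open>At \<open>k = 0\<close> the value is 1, so the equality holds only
    eventually.\<close>
  have "heads_tail (nat (2 * int k + -1)) k = 1 / 2" if "k > 0" for k
  proof -
    obtain j where "k = j + 1" using \<open>k > 0\<close> by (metis Suc_eq_plus1 gr0_implies_Suc)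
    moreover from this have "nat (2 * int k + -1) = 2 * j + 1" by simp
    ultimately show ?thesis using heads_tail_half by metis
  qed
  then have "\<forall>\<^sub>F k in sequentially. heads_tail (nat (2 * int k + -1)) k = 1 / 2"
    using eventually_gt_at_top by (rule eventually_mono[rotated])
  then show ?case by (rule tendsto_eventually)
next
  case (step1 i)
  from tendsto_add[OF heads_tail_shift_diff_tendsto_0[of i] step1(2)]
  show ?case by simp
next
  case (step2 i)
  from tendsto_diff[OF step2(2) heads_tail_shift_diff_tendsto_0[of "i - 1"]]
  show ?case by simp
qed

theorem theorem4p2:
  shows "(\<forall>k::nat. k \<ge> 1 \<longrightarrow> omni_prob (3 * k - 1) k 2 = 1 / 2) \<and>
         (\<forall>c::int. (\<lambda>k::nat. omni_prob (nat (3 * int k + c)) k 2) \<longlonglongrightarrow> 1 / 2)"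
proof (intro conjI allI impI)
  fix k :: nat assume "k \<ge> 1"
  then obtain j where "k = j + 1" by (metis add.commute le_Suc_ex)
  then have "3 * k - 1 - k = 2 * j + 1" "k = j + 1" by simp_all
  then show "omni_prob (3 * k - 1) k 2 = 1 / 2"
    using heads_tail_half[of j] by (simp add: omni_prob_2)
next
  fix c :: int
  \<comment> \<open>Both truncations agree: each side is 0 when \<open>2 * int k + c\<close> is
    negative.\<close>
  have "nat (3 * int k + c) - k = nat (2 * int k + c)" for k
    by linarith
  then show "(\<lambda>k. omni_prob (nat (3 * int k + c)) k 2) \<longlonglongrightarrow> 1 / 2"
    using heads_tail_tendsto_half by (simp add: omni_prob_2)
qed

end
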